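(* Let $n\ge2$, $m\ge1$ and fix $\nu=(\nu_1,\dots,\nu_m)$ with all $\nu_a\in\{1,\dots,n-1\}$. For $\mu\in\mathbb C^m$ put $\lambda=\mu+\nu$. Let $I(\mu)$ be the operator-valued rational function of $\mu$ obtained by restricting $P_\nu B(\mu)$ to the subspace $\Lambda^{\nu_1}(\mathbb C^n)\otimes\cdots\otimes\Lambda^{\nu_m}(\mathbb C^n)\subset(\mathbb C^n)^{\otimes N}$ and dividing by the scalar rational function $\beta(\mu)$ (all defined in the context). Then $I(\mu)$ is regular at any point $\mu\in\mathbb C^m$ where the weight $\lambda+\rho$ is dominant.
   Context: Weights of $\mathfrak{gl}_m$ are identified with their label sequences in $\mathbb C^m$; $\rho_a=m/2-a+1/2$. $\lambda+\rho$ is dominant if $\lambda_a+\rho_a-\lambda_b-\rho_b\notin\{-1,-2,\dots\}$ whenever $a<b$. Put $N=\nu_1+\dots+\nu_m$ and split $1,\dots,N$ into consecutive segments of lengths $\nu_1,\dots,\nu_m$. For $p=\nu_1+\dots+\nu_{a-1}+i$ with $1\le i\le\nu_a$ (the $i$th element of the $a$th segment) put $x_p=\mu_a+\rho_a+\frac12+\nu_a-i$. Let $1',\dots,N'$ be the sequence obtained from $1,\dots,N$ by reversing the order of the segments while keeping the order within each segment; let $1'',\dots,N''$ be obtained by reversing the order within each segment while keeping the order of the segments. $P_\nu$ is the operator on $(\mathbb C^n)^{\otimes N}$ with $v_1\otimes\dots\otimes v_N\mapsto v_{1'}\otimes\dots\otimes v_{N'}$. Let $P$ be the flip on $\mathbb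 C^n\otimes\mathbb C^n$, $R(x)=1-P\,x^{-1}$, and let $R_{pq}(x)$ be $R(x)$ acting in the $p$th and $q$th tensor factors of $(\mathbb C^n)^{\otimes N}$. Put $$B(\mu)=\prod_{(p,q)}^{\longrightarrow}R_{pq}(x_q-x_p),$$ the product over pairs $p<q$ belonging to different segments, arranged from left to right so that $(p,q)$ precedes $(r,s)$ if $p<r$, or if $p=r$ and $q$ precedes $s$ in the sequence $1'',\dots,N''$. The operator $B(\mu)$ preserves the subspace $\Lambda^{\nu_1}(\mathbb C^n)\otimes\cdots\otimes\Lambda^{\nu_m}(\mathbb C^n)$ (antisymmetric tensors within each segment). The scalar function is $$\beta(\mu)=\prod_{1\le a<b\le m}\begin{cases}\dfrac{\lambda_a-\lambda_b+\rho_a-\rho_b+\nu_b}{\mu_a-\mu_b+\rho_a-\rho_b}&\text{if }\nu_a\le\nu_b,\\[2mm]\dfrac{\lambda_a-\lambda_b+\rho_a-\rho_b+\nu_b}{\lambda_a-\lambda_b+\rho_a-\rho_b}&\text{if }\nu_a\ge\nu_b.\end{cases}$$ (The two expressions agree if $\nu_a=\nu_b$.) *)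

theory Defs
  imports Complex_Main "HOL-Library.FuncSet" "HOL-Combinatorics.Permutations"
begin

section \<open>Regular points of rational functions on affine space\<close>

text \<open>
  A point of the \<open>m\<close>-dimensional complex space is a function \<open>nat \<Rightarrow> complex\<close>, of which only
  the coordinates \<open>1, \<dots>, m\<close> are ever used.
\<close>

inductive polynomial_fun :: "nat \<Rightarrow> ((nat \<Rightarrow> complex) \<Rightarrow> complex) \<Rightarrow> bool" for m :: nat where
  const: "polynomial_fun m (\<lambda>_. c)"
| coord: "a \<in> {1..m} \<Longrightarrow> polynomial_fun m (\<lambda>z. z a)"
| add: "polynomial_fun m f \<Longrightarrow> polynomial_fun m g \<Longrightarrow> polynomial_fun m (\<lambda>z. f z + g z)"
| mult: "polynomial_fun m f \<Longrightarrow> polynomial_fun m g \<Longrightarrow> polynomial_fun m (\<lambda>z. f z * g z)"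

text \<open>
  A rational function is given here by a formula \<open>f\<close> whose values matter only generically, that
  is, off the zero set of some nonzero polynomial \<open>h\<close>; on its poles the formula takes meaningless
  values, by the convention \<open>x / 0 = 0\<close>. Such a function is regular at \<open>z\<^sub>0\<close> if it equals, as a
  rational function, a quotient of polynomials with denominator nonzero at \<open>z\<^sub>0\<close>. In particular,
  regularity does not refer to the value \<open>f z\<^sub>0\<close>.
\<close>

definition regular_at :: "nat \<Rightarrow> ((nat \<Rightarrow> complex) \<Rightarrow> complex) \<Rightarrow> (nat \<Rightarrow> complex) \<Rightarrow> bool" where
  "regular_at m f z\<^sub>0 \<longleftrightarrow>
     (\<exists>p q. polynomial_fun m p \<and> polynomial_fun m q \<and> q z\<^sub>0 \<noteq> 0 \<and>
       (\<exists>h. polynomial_fun m h \<and> (\<exists>z. h z \<noteq> 0) \<and>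
         (\<forall>z. h z \<noteq> 0 \<longrightarrow> q z \<noteq> 0 \<and> f z = p z / q z)))"


section \<open>Tensors\<close>

text \<open>
  A tensor in the \<open>N\<close>-th tensor power of the \<open>n\<close>-dimensional complex space is the family of its
  coefficients with respect to the standard basis, indexed by the multi-indices
  \<open>{1..N} \<rightarrow>\<^sub>E {1..n}\<close> and extended by zero.
\<close>

type_synonym tensor = "(nat \<Rightarrow> nat) \<Rightarrow> complex"

definition tensors :: "nat \<Rightarrow> nat \<Rightarrow> tensor set" where
  "tensors n N = {t. \<forall>j. j \<notin> {1..N} \<rightarrow>\<^sub>E {1..n} \<longrightarrow> t j = 0}"

definition pure_tensor :: "nat \<Rightarrow> nat \<Rightarrow> (nat \<Rightarrow> nat \<Rightarrow> complex) \<Rightarrow> tensor" where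
  "pure_tensor n N v = (\<lambda>j. if j \<in> {1..N} \<rightarrow>\<^sub>E {1..n} then \<Prod>p=1..N. v p (j p) else 0)"

text \<open>
  The linear operator that takes the tensor product of \<open>v 1, \<dots>, v N\<close> to that of
  \<open>v (\<sigma> 1), \<dots>, v (\<sigma> N)\<close>, see \<open>permute_pure_tensor\<close>.
\<close>

definition permute_tensor :: "(nat \<Rightarrow> nat) \<Rightarrow> tensor \<Rightarrow> tensor" where
  "permute_tensor \<sigma> t = (\<lambda>j. t (j \<circ> inv \<sigma>))"

lemma permute_pure_tensor:
  assumes "\<sigma> permutes {1..N}"
  shows "permute_tensor \<sigma> (pure_tensor n N v) = pure_tensor n N (v \<circ> \<sigma>)"
proof
  fix j :: "nat \<Rightarrow> nat"
  have inv: "inv \<sigma> permutes {1..N}"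
    using assms by (rule permutes_inv)
  have PiE_comp: "g \<circ> \<pi> \<in> {1..N} \<rightarrow>\<^sub>E {1..n}"
    if "g \<in> {1..N} \<rightarrow>\<^sub>E {1..n}" "\<pi> permutes {1..N}" for g \<pi> :: "nat \<Rightarrow> nat"
    using that permutes_in_image[OF that(2)] permutes_not_in[OF that(2)]
    by (fastforce simp: PiE_iff extensional_def)
  have "(j \<circ> inv \<sigma>) \<circ> \<sigma> = j"
    using permutes_inv_o(2)[OF assms] by (simp add: comp_assoc)
  then have iff: "j \<circ> inv \<sigma> \<in> {1..N} \<rightarrow>\<^sub>E {1..n} \<longleftrightarrow> j \<in> {1..N} \<rightarrow>\<^sub>E {1..n}"
    using PiE_comp[OF _ inv] PiE_comp[OF _ assms] by metis
  have "(\<Prod>p=1..N. v p ((j \<circ> inv \<sigma>) p)) = (\<Prod>p=1..N. v (\<sigma> p) (j p))"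
    using prod.permute[OF assms, of "\<lambda>p. v p ((j \<circ> inv \<sigma>) p)"]
    by (simp add: o_def permutes_inverses(2)[OF assms])
  with iff show "permute_tensor \<sigma> (pure_tensor n N v) j = pure_tensor n N (v \<circ> \<sigma>) j"
    by (simp add: permute_tensor_def pure_tensor_def o_def)
qed

definition flip_tensor :: "nat \<Rightarrow> nat \<Rightarrow> tensor \<Rightarrow> tensor" where
  "flip_tensor p q = permute_tensor (transpose p q)"

definition R_op :: "nat \<Rightarrow> nat \<Rightarrow> complex \<Rightarrow> tensor \<Rightarrow> tensor" where
  "R_op p q x t = (\<lambda>j. t j - inverse x * flip_tensor p q t j)"


section \<open>Segments\<close>

text \<open>Segment number \<open>a\<close> consists of \<open>\<nu> 1 + \<dots> + \<nu> (a - 1) + i\<close> for \<open>i = 1, \<dots>, \<nu> a\<close>.\<close>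

definition partial_sum :: "(nat \<Rightarrow> nat) \<Rightarrow> nat \<Rightarrow> nat" where
  "partial_sum \<nu> a = (\<Sum>c=1..a. \<nu> c)"

definition segment :: "(nat \<Rightarrow> nat) \<Rightarrow> nat \<Rightarrow> nat list" where
  "segment \<nu> a = [partial_sum \<nu> (a - 1) + 1 ..< partial_sum \<nu> a + 1]"

definition segment_of :: "nat \<Rightarrow> (nat \<Rightarrow> nat) \<Rightarrow> nat \<Rightarrow> nat" where
  "segment_of m \<nu> p = (THE a. a \<in> {1..m} \<and> p \<in> set (segment \<nu> a))"

text \<open>The sequences \<open>1', \<dots>, N'\<close> and \<open>1'', \<dots>, N''\<close>.\<close>

definition primed_seq :: "nat \<Rightarrow> (nat \<Rightarrow> nat) \<Rightarrow> nat list" where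
  "primed_seq m \<nu> = concat (map (segment \<nu>) (rev [1..<m+1]))"

definition double_primed_seq :: "nat \<Rightarrow> (nat \<Rightarrow> nat) \<Rightarrow> nat list" where
  "double_primed_seq m \<nu> = concat (map (\<lambda>a. rev (segment \<nu> a)) [1..<m+1])"

text \<open>The map \<open>k \<mapsto> k'\<close>. It fixes everything outside \<open>{1..N}\<close>; list positions count from \<open>0\<close>.\<close>

definition prime_perm :: "nat \<Rightarrow> (nat \<Rightarrow> nat) \<Rightarrow> nat \<Rightarrow> nat" where
  "prime_perm m \<nu> k = (if k \<in> {1..partial_sum \<nu> m} then primed_seq m \<nu> ! (k - 1) else k)"

definition P_op :: "nat \<Rightarrow> (nat \<Rightarrow> nat) \<Rightarrow> tensor \<Rightarrow> tensor" where
  "P_op m \<nu> = permute_tensor (prime_perm m \<nu>)"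

text \<open>The tensor product of the exterior powers of degrees \<open>\<nu> 1, \<dots>, \<nu> m\<close>.\<close>

definition exterior_tensors :: "nat \<Rightarrow> nat \<Rightarrow> (nat \<Rightarrow> nat) \<Rightarrow> tensor set" where
  "exterior_tensors n m \<nu> =
     {t \<in> tensors n (partial_sum \<nu> m).
        \<forall>a\<in>{1..m}. \<forall>p\<in>set (segment \<nu> a). \<forall>q\<in>set (segment \<nu> a).
          p \<noteq> q \<longrightarrow> flip_tensor p q t = (\<lambda>j. - t j)}"


section \<open>Weights and the operator \<open>I(\<mu>)\<close>\<close>

definition rho :: "nat \<Rightarrow> nat \<Rightarrow> complex" where
  "rho m a = of_nat m / 2 - of_nat a + 1 / 2"

text \<open>In the next definition \<open>\<kappa>\<close> is the shifted weight \<open>\<lambda> + \<rho>\<close>.\<close>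

definition dominant :: "nat \<Rightarrow> (nat \<Rightarrow> complex) \<Rightarrow> bool" where
  "dominant m \<kappa> \<longleftrightarrow>
     (\<forall>a b. 1 \<le> a \<and> a < b \<and> b \<le> m \<longrightarrow> \<kappa> a - \<kappa> b \<notin> {- of_nat k | k :: nat. k \<ge> 1})"

definition x_param :: "nat \<Rightarrow> (nat \<Rightarrow> nat) \<Rightarrow> (nat \<Rightarrow> complex) \<Rightarrow> nat \<Rightarrow> complex" where
  "x_param m \<nu> \<mu> p =
     (let a = segment_of m \<nu> p; i = p - partial_sum \<nu> (a - 1)
      in \<mu> a + rho m a + 1 / 2 + of_nat (\<nu> a) - of_nat i)"

definition B_pairs :: "nat \<Rightarrow> (nat \<Rightarrow> nat) \<Rightarrow> (nat \<times> nat) list" where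
  "B_pairs m \<nu> =
     [(p, q). p \<leftarrow> [1..<partial_sum \<nu> m + 1], q \<leftarrow> double_primed_seq m \<nu>,
              p < q \<and> segment_of m \<nu> p \<noteq> segment_of m \<nu> q]"

text \<open>As in any product of operators, the leftmost factor is the one applied last.\<close>

definition B_op :: "nat \<Rightarrow> (nat \<Rightarrow> nat) \<Rightarrow> (nat \<Rightarrow> complex) \<Rightarrow> tensor \<Rightarrow> tensor" where
  "B_op m \<nu> \<mu> =
     foldr (\<lambda>(p, q) F. R_op p q (x_param m \<nu> \<mu> q - x_param m \<nu> \<mu> p) \<circ> F) (B_pairs m \<nu>) id"

definition beta :: "nat \<Rightarrow> (nat \<Rightarrow> nat) \<Rightarrow> (nat \<Rightarrow> complex) \<Rightarrow> complex" where
  "beta m \<nu> \<mu> =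
     (let l = (\<lambda>a. \<mu> a + of_nat (\<nu> a)) in
      \<Prod>(a, b) \<in> {(a, b). 1 \<le> a \<and> a < b \<and> b \<le> m}.
        if \<nu> a \<le> \<nu> b
        then (l a - l b + rho m a - rho m b + of_nat (\<nu> b)) / (\<mu> a - \<mu> b + rho m a - rho m b)
        else (l a - l b + rho m a - rho m b + of_nat (\<nu> b)) / (l a - l b + rho m a - rho m b))"

definition I_op :: "nat \<Rightarrow> (nat \<Rightarrow> nat) \<Rightarrow> (nat \<Rightarrow> complex) \<Rightarrow> tensor \<Rightarrow> tensor" where
  "I_op m \<nu> \<mu> t = (\<lambda>j. P_op m \<nu> (B_op m \<nu> \<mu> t) j / beta m \<nu> \<mu>)"

text \<open>
  Regularity of a family of linear operators on tensors, restricted to the subspace \<open>V\<close>: all the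
  coefficients of the images of the vectors in \<open>V\<close> (equivalently, in a basis of \<open>V\<close>) are regular.
\<close>

definition operator_regular_at ::
    "nat \<Rightarrow> tensor set \<Rightarrow> ((nat \<Rightarrow> complex) \<Rightarrow> tensor \<Rightarrow> tensor) \<Rightarrow> (nat \<Rightarrow> complex) \<Rightarrow> bool" where
  "operator_regular_at m V F z\<^sub>0 \<longleftrightarrow> (\<forall>t\<in>V. \<forall>j. regular_at m (\<lambda>z. F z t j) z\<^sub>0)"

end

theory Submission
  imports Defs "HOL-Computational_Algebra.Polynomial"
begin

text \<open>
  Interchanging only factors that act in disjoint pairs of positions, \<open>B(\<mu>)\<close> becomes a product of
  blocks, one for each pair of segments \<open>a < c\<close>, and each block can be multiplied out row by row
  (fixing a position in segment \<open>a\<close>) or column by column (fixing one in segment \<open>c\<close>). On tensors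
  antisymmetric in a segment, the product of the \<open>R\<close>-matrices joining one position \<open>p\<close> to that whole
  segment collapses to \<open>1\<close> plus a single fraction times the sum of the flips \<open>P\<^sub>p\<^sub>q\<close>. So every row and
  every column contributes at most one simple pole, and for dominant \<open>\<lambda> + \<rho>\<close> either the rows show
  that there is no pole, or the columns show that there is only one, which \<open>1 / \<beta>\<close> cancels.
\<close>

section \<open>Regular functions\<close>

text \<open>Restriction to a line reduces questions about \<open>polynomial_fun\<close> to
  univariate \<open>poly\<close>, whose ring has no zero divisors.\<close>

lemma polynomial_fun_on_line:
  assumes "polynomial_fun m f"
  shows "\<exists>p. \<forall>s. f (\<lambda>a. u a + s * v a) = poly p s"
  using assms
proof induction
  case (const c)
  show ?case by (rule exI[of _ "[:c:]"]) simp
next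
  case (coord a)
  show ?case by (rule exI[of _ "[:u a, v a:]"]) simp
next
  case (add f g)
  then obtain p q where "\<forall>s. f (\<lambda>a. u a + s * v a) = poly p s" "\<forall>s. g (\<lambda>a. u a + s * v a) = poly q s"
    by blast
  then show ?case by (intro exI[of _ "p + q"]) simp
next
  case (mult f g)
  then obtain p q where "\<forall>s. f (\<lambda>a. u a + s * v a) = poly p s" "\<forall>s. g (\<lambda>a. u a + s * v a) = poly q s"
    by blast
  then show ?case by (intro exI[of _ "p * q"]) simp
qed

text \<open>On the line through \<open>u\<close> and \<open>w\<close> both factors restrict to
  nonzero univariate polynomials: \<open>s = 0\<close> detects \<open>f\<close> and
  \<open>s = 1\<close> detects \<open>g\<close>.\<close>

lemma polynomial_fun_mult_nonzero:
  assumes "polynomial_fun m f" "polynomial_fun m g" "f u \<noteq> 0" "g w \<noteq> 0"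
  shows "\<exists>z. f z * g z \<noteq> 0"
proof -
  obtain p where p: "\<And>s. f (\<lambda>a. u a + s * (w a - u a)) = poly p s"
    using polynomial_fun_on_line[OF assms(1), of u "\<lambda>a. w a - u a"] by blast
  obtain q where q: "\<And>s. g (\<lambda>a. u a + s * (w a - u a)) = poly q s"
    using polynomial_fun_on_line[OF assms(2), of u "\<lambda>a. w a - u a"] by blast
  from p[of 0] assms(3) have "p \<noteq> 0" by auto
  moreover from q[of 1] assms(4) have "q \<noteq> 0" by auto
  ultimately have "p * q \<noteq> 0" by simp
  then obtain s where "poly (p * q) s \<noteq> 0"
    using poly_all_0_iff_0 by blast
  with p[of s] q[of s] show ?thesis by (metis poly_mult)
qed

text \<open>Truth on some nonempty basic Zariski-open set. Such sets are closed under finite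
  intersection, so identities valid off various poles can be combined.\<close>

definition generically :: "nat \<Rightarrow> ((nat \<Rightarrow> complex) \<Rightarrow> bool) \<Rightarrow> bool" where
  "generically m P \<longleftrightarrow> (\<exists>h. polynomial_fun m h \<and> (\<exists>z. h z \<noteq> 0) \<and> (\<forall>z. h z \<noteq> 0 \<longrightarrow> P z))"

lemma regular_at_iff:
  "regular_at m f z0 \<longleftrightarrow>
    (\<exists>p q. polynomial_fun m p \<and> polynomial_fun m q \<and> q z0 \<noteq> 0 \<and>
      generically m (\<lambda>z. q z \<noteq> 0 \<and> f z = p z / q z))"
  by (simp add: regular_at_def generically_def)

lemma generically_mono:
  assumes "generically m P" "\<And>z. P z \<Longrightarrow> Q z"
  shows "generically m Q"
  using assms unfolding generically_def by blast

lemma generically_True: "generically m (\<lambda>_. True)"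
  unfolding generically_def by (rule exI[of _ "\<lambda>_. 1"]) (simp add: polynomial_fun.const)

lemma generically_conj:
  assumes "generically m P" "generically m Q"
  shows "generically m (\<lambda>z. P z \<and> Q z)"
proof -
  obtain f u where f: "polynomial_fun m f" "f u \<noteq> 0" "\<forall>z. f z \<noteq> 0 \<longrightarrow> P z"
    using assms(1) by (auto simp: generically_def)
  obtain g w where g: "polynomial_fun m g" "g w \<noteq> 0" "\<forall>z. g z \<noteq> 0 \<longrightarrow> Q z"
    using assms(2) by (auto simp: generically_def)
  show ?thesis
    unfolding generically_def
    using f(3) g(3) polynomial_fun_mult_nonzero[OF f(1) g(1) f(2) g(2)]
    by (intro exI[of _ "\<lambda>z. f z * g z"]) (simp add: polynomial_fun.mult[OF f(1) g(1)])
qed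

lemma generically_ball:
  assumes "finite A" "\<And>i. i \<in> A \<Longrightarrow> generically m (P i)"
  shows "generically m (\<lambda>z. \<forall>i\<in>A. P i z)"
  using assms
proof (induction rule: finite_induct)
  case empty
  show ?case using generically_True by simp
next
  case (insert i A)
  then show ?case by (auto intro!: generically_conj)
qed

section \<open>Closure properties of polynomial functions and of regularity at a point\<close>

lemma polynomial_fun_coord_add:
  "a \<in> {1..m} \<Longrightarrow> polynomial_fun m (\<lambda>z. z a + c)"
  by (intro polynomial_fun.intros)

lemma polynomial_fun_uminus:
  assumes "polynomial_fun m f"
  shows "polynomial_fun m (\<lambda>z. - f z)"
  using polynomial_fun.mult[OF polynomial_fun.const[of m "-1"] assms] by simp

lemma polynomial_fun_diff:
  assumes "polynomial_fun m f" "polynomial_fun m g"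
  shows "polynomial_fun m (\<lambda>z. f z - g z)"
  using polynomial_fun.add[OF assms(1) polynomial_fun_uminus[OF assms(2)]] by simp

text \<open>Fused formulas are known to agree with products of \<open>R\<close>-matrices only where
  no denominator vanishes; this carries regularity across such partial identities.\<close>

lemma regular_at_generic_cong:
  assumes "regular_at m f z0" "generically m P" "\<And>z. P z \<Longrightarrow> f z = g z"
  shows "regular_at m g z0"
proof -
  obtain p q where pq: "polynomial_fun m p" "polynomial_fun m q" "q z0 \<noteq> 0"
      "generically m (\<lambda>z. q z \<noteq> 0 \<and> f z = p z / q z)"
    using assms(1) by (auto simp: regular_at_iff)
  have "generically m (\<lambda>z. q z \<noteq> 0 \<and> g z = p z / q z)"
    by (rule generically_mono[OF generically_conj[OF pq(4) assms(2)]]) (auto simp: assms(3))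
  with pq(1-3) show ?thesis by (auto simp: regular_at_iff)
qed

lemma regular_at_polynomial_fun:
  assumes "polynomial_fun m f"
  shows "regular_at m f z0"
  unfolding regular_at_iff
  by (intro exI[of _ f] exI[of _ "\<lambda>_. 1"])
     (auto simp: assms generically_True intro: polynomial_fun.const)

lemma regular_at_const: "regular_at m (\<lambda>_. c) z0"
  by (intro regular_at_polynomial_fun polynomial_fun.const)

lemma regular_at_inverse:
  assumes "polynomial_fun m f" "f z0 \<noteq> 0"
  shows "regular_at m (\<lambda>z. inverse (f z)) z0"
  unfolding regular_at_iff generically_def
  by (rule exI[of _ "\<lambda>_. 1"], rule exI[of _ f])
     (use assms in \<open>auto simp: divide_inverse intro!: polynomial_fun.const exI[of _ f]\<close>)

lemma regular_at_add:
  assumes "regular_at m f z0" "regular_at m g z0"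
  shows "regular_at m (\<lambda>z. f z + g z) z0"
proof -
  obtain p q where f: "polynomial_fun m p" "polynomial_fun m q" "q z0 \<noteq> 0"
      "generically m (\<lambda>z. q z \<noteq> 0 \<and> f z = p z / q z)"
    using assms(1) by (auto simp: regular_at_iff)
  obtain r s where g: "polynomial_fun m r" "polynomial_fun m s" "s z0 \<noteq> 0"
      "generically m (\<lambda>z. s z \<noteq> 0 \<and> g z = r z / s z)"
    using assms(2) by (auto simp: regular_at_iff)
  have "generically m (\<lambda>z. q z * s z \<noteq> 0 \<and> f z + g z = (p z * s z + r z * q z) / (q z * s z))"
    by (rule generically_mono[OF generically_conj[OF f(4) g(4)]]) (auto simp: add_frac_eq)
  moreover have "polynomial_fun m (\<lambda>z. p z * s z + r z * q z)" "polynomial_fun m (\<lambda>z. q z * s z)"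
    using f g by (auto intro!: polynomial_fun.add polynomial_fun.mult)
  ultimately show ?thesis
    unfolding regular_at_iff using f(3) g(3)
    by (intro exI[of _ "\<lambda>z. p z * s z + r z * q z"] exI[of _ "\<lambda>z. q z * s z"]) simp
qed

lemma regular_at_mult:
  assumes "regular_at m f z0" "regular_at m g z0"
  shows "regular_at m (\<lambda>z. f z * g z) z0"
proof -
  obtain p q where f: "polynomial_fun m p" "polynomial_fun m q" "q z0 \<noteq> 0"
      "generically m (\<lambda>z. q z \<noteq> 0 \<and> f z = p z / q z)"
    using assms(1) by (auto simp: regular_at_iff)
  obtain r s where g: "polynomial_fun m r" "polynomial_fun m s" "s z0 \<noteq> 0"
      "generically m (\<lambda>z. s z \<noteq> 0 \<and> g z = r z / s z)"
    using assms(2) by (auto simp: regular_at_iff)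
  have "generically m (\<lambda>z. q z * s z \<noteq> 0 \<and> f z * g z = (p z * r z) / (q z * s z))"
    by (rule generically_mono[OF generically_conj[OF f(4) g(4)]]) auto
  moreover have "polynomial_fun m (\<lambda>z. p z * r z)" "polynomial_fun m (\<lambda>z. q z * s z)"
    using f g by (auto intro!: polynomial_fun.mult)
  ultimately show ?thesis
    unfolding regular_at_iff using f(3) g(3)
    by (intro exI[of _ "\<lambda>z. p z * r z"] exI[of _ "\<lambda>z. q z * s z"]) simp
qed

lemma regular_at_sum:
  assumes "\<And>i. i \<in> A \<Longrightarrow> regular_at m (f i) z0"
  shows "regular_at m (\<lambda>z. \<Sum>i\<in>A. f i z) z0"
  using assms
  by (induction A rule: infinite_finite_induct) (auto intro: regular_at_const regular_at_add)


section \<open>Flips and antisymmetric tensors\<close>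

lemma flip_tensor_apply: "flip_tensor p q t j = t (j \<circ> transpose p q)"
  by (simp add: flip_tensor_def permute_tensor_def inv_equality)

lemma flip_tensor_commute: "flip_tensor p q = flip_tensor q p"
  by (simp add: flip_tensor_def transpose_commute)

lemma flip_tensor_conj:
  assumes "p \<noteq> q"
  shows "flip_tensor p q (flip_tensor c l t)
    = flip_tensor (transpose p q c) (transpose p q l) (flip_tensor p q t)"
proof
  fix j :: "nat \<Rightarrow> nat"
  have "transpose p q \<circ> transpose c l
      = transpose (transpose p q c) (transpose p q l) \<circ> transpose p q"
    by (auto simp: fun_eq_iff transpose_def)
  then show "flip_tensor p q (flip_tensor c l t) j
      = flip_tensor (transpose p q c) (transpose p q l) (flip_tensor p q t) j"
    by (simp add: flip_tensor_apply comp_assoc)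
qed

lemma flip_tensor_disjoint:
  assumes "{p, q} \<inter> {r, s} = {}"
  shows "flip_tensor p q (flip_tensor r s t) = flip_tensor r s (flip_tensor p q t)"
proof (cases "p = q")
  case True
  then show ?thesis by (simp add: flip_tensor_apply fun_eq_iff)
next
  case False
  with assms show ?thesis by (subst flip_tensor_conj) (auto simp: transpose_def)
qed

definition antisymmetric_in :: "nat set \<Rightarrow> tensor \<Rightarrow> bool" where
  "antisymmetric_in S t \<longleftrightarrow> (\<forall>p\<in>S. \<forall>q\<in>S. p \<noteq> q \<longrightarrow> flip_tensor p q t = (\<lambda>j. - t j))"

lemma antisymmetric_in_subset:
  "antisymmetric_in S t \<Longrightarrow> U \<subseteq> S \<Longrightarrow> antisymmetric_in U t"
  unfolding antisymmetric_in_def by blast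

lemma flip_tensor_linear:
  "flip_tensor p q (\<lambda>j. t j + c * (\<Sum>l\<in>A. u l j))
    = (\<lambda>j. flip_tensor p q t j + c * (\<Sum>l\<in>A. flip_tensor p q (u l) j))"
  by (simp add: flip_tensor_apply fun_eq_iff)

lemma flip_tensor_scale: "flip_tensor p q (\<lambda>j. c * t j) = (\<lambda>j. c * flip_tensor p q t j)"
  by (simp add: flip_tensor_apply fun_eq_iff)

lemma flip_tensor_minus: "flip_tensor p q (\<lambda>j. - t j) = (\<lambda>j. - flip_tensor p q t j)"
  by (simp add: flip_tensor_apply fun_eq_iff)

lemma antisymmetric_in_scale:
  assumes "antisymmetric_in S t"
  shows "antisymmetric_in S (\<lambda>j. c * t j)"
  using assms by (auto simp: antisymmetric_in_def flip_tensor_scale)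

text \<open>A flip inside \<open>S\<close> fixes \<open>c\<close>, so it merely permutes the
  summands while \<open>t\<close> contributes the sign. Sums of this shape are what
  \<open>R_prod_star\<close> produces.\<close>

lemma antisymmetric_in_star:
  assumes "antisymmetric_in S t" "c \<notin> S"
  shows "antisymmetric_in S (\<lambda>j. t j + w * (\<Sum>l\<in>S. flip_tensor c l t j))"
  unfolding antisymmetric_in_def
proof (intro ballI impI ext)
  fix p q j
  assume pq: "p \<in> S" "q \<in> S" "p \<noteq> q"
  with assms have t: "flip_tensor p q t = (\<lambda>j. - t j)" and c: "transpose p q c = c"
    by (auto simp: antisymmetric_in_def transpose_def)
  have bij: "bij_betw (transpose p q) S S"
    using pq by (simp add: bij_betw_transpose_iff)
  have "flip_tensor p q (\<lambda>j. t j + w * (\<Sum>l\<in>S. flip_tensor c l t j)) j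
      = - t j + w * (\<Sum>l\<in>S. - flip_tensor c (transpose p q l) t j)"
    by (simp add: flip_tensor_linear flip_tensor_conj[OF pq(3)] c t flip_tensor_minus)
  also have "(\<Sum>l\<in>S. - flip_tensor c (transpose p q l) t j) = (\<Sum>l\<in>S. - flip_tensor c l t j)"
    by (rule sum.reindex_bij_betw[OF bij])
  finally show "flip_tensor p q (\<lambda>j. t j + w * (\<Sum>l\<in>S. flip_tensor c l t j)) j
      = - (t j + w * (\<Sum>l\<in>S. flip_tensor c l t j))"
    by (simp add: sum_negf)
qed


section \<open>Products of \<open>R\<close>-matrices\<close>

text \<open>\<open>B_op\<close> with the list of pairs and the parameters left free, so that lists
  can be split, reordered and transposed.\<close>

definition R_prod :: "(nat \<Rightarrow> complex) \<Rightarrow> (nat \<times> nat) list \<Rightarrow> tensor \<Rightarrow> tensor" where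
  "R_prod x L = foldr (\<lambda>(p, q) F. R_op p q (x q - x p) \<circ> F) L id"

lemma R_prod_Nil [simp]: "R_prod x [] t = t"
  by (simp add: R_prod_def)

lemma R_prod_Cons [simp]: "R_prod x ((p, q) # L) t = R_op p q (x q - x p) (R_prod x L t)"
  by (simp add: R_prod_def)

lemma R_prod_append [simp]: "R_prod x (K @ L) t = R_prod x K (R_prod x L t)"
  by (induction K) auto

text \<open>The flip is symmetric in its two positions, whereas the argument of \<open>R\<close>
  changes sign. Columns thereby become rows for the negated parameters.\<close>

lemma R_prod_swap: "R_prod x (map prod.swap L) = R_prod (\<lambda>p. - x p) L"
proof
  show "R_prod x (map prod.swap L) t = R_prod (\<lambda>p. - x p) L t" for t
    by (induction L) (auto simp: R_op_def flip_tensor_commute)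
qed

lemma R_prod_scale: "R_prod x L (\<lambda>j. c * t j) = (\<lambda>j. c * R_prod x L t j)"
  by (induction L) (auto simp: R_op_def flip_tensor_scale algebra_simps)

definition disjoint_pairs :: "(nat \<times> nat) list \<Rightarrow> (nat \<times> nat) list \<Rightarrow> bool" where
  "disjoint_pairs K L \<longleftrightarrow> (\<forall>(p, q)\<in>set K. \<forall>(r, s)\<in>set L. {p, q} \<inter> {r, s} = {})"

lemma flip_tensor_R_op:
  assumes "{p, q} \<inter> {r, s} = {}"
  shows "flip_tensor r s (R_op p q y t) = R_op p q y (flip_tensor r s t)"
proof
  fix j
  have "flip_tensor r s (R_op p q y t) j
      = flip_tensor r s t j - inverse y * flip_tensor r s (flip_tensor p q t) j"
    by (simp add: R_op_def flip_tensor_apply)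
  then show "flip_tensor r s (R_op p q y t) j = R_op p q y (flip_tensor r s t) j"
    using flip_tensor_disjoint[OF assms] by (simp add: R_op_def)
qed

lemma R_op_commute:
  assumes "{p, q} \<inter> {r, s} = {}"
  shows "R_op p q y (R_op r s w t) = R_op r s w (R_op p q y t)"
proof
  fix j
  have "flip_tensor r s (R_op p q y t) = R_op p q y (flip_tensor r s t)"
    by (rule flip_tensor_R_op[OF assms])
  then show "R_op p q y (R_op r s w t) j = R_op r s w (R_op p q y t) j"
    by (simp add: R_op_def flip_tensor_apply algebra_simps)
qed

lemma R_op_R_prod_commute:
  assumes "disjoint_pairs [(p, q)] L"
  shows "R_op p q y (R_prod x L t) = R_prod x L (R_op p q y t)"
  using assms
proof (induction L)
  case (Cons e L)
  obtain r s where e: "e = (r, s)" by fastforce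
  with Cons.prems have dj: "{p, q} \<inter> {r, s} = {}" and "disjoint_pairs [(p, q)] L"
    by (auto simp: disjoint_pairs_def)
  with Cons.IH show ?case by (simp add: e R_op_commute[OF dj])
qed simp

lemma R_prod_commute:
  assumes "disjoint_pairs K L"
  shows "R_prod x K (R_prod x L t) = R_prod x L (R_prod x K t)"
  using assms
proof (induction K)
  case (Cons e K)
  obtain p q where e: "e = (p, q)" by fastforce
  with Cons.prems have "disjoint_pairs [(p, q)] L" "disjoint_pairs K L"
    by (auto simp: disjoint_pairs_def)
  with Cons.IH show ?case by (simp add: e R_op_R_prod_commute)
qed simp

text \<open>Only \<open>G i\<close> and the \<open>F k\<close> of later indices \<open>k\<close>
  trade places, and these are disjoint.\<close>

lemma R_prod_concat_append:
  assumes "distinct is"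
    and "\<And>i k. i \<in> set is \<Longrightarrow> k \<in> set is \<Longrightarrow> i \<noteq> k \<Longrightarrow> disjoint_pairs (G i) (F k)"
  shows "R_prod x (concat (map (\<lambda>i. F i @ G i) is)) t
    = R_prod x (concat (map F is)) (R_prod x (concat (map G is)) t)"
  using assms
proof (induction "is")
  case (Cons i "is")
  have "disjoint_pairs (G i) (F k)" if "k \<in> set is" for k
    using Cons.prems that by auto
  then have dj: "disjoint_pairs (G i) (concat (map F is))"
    by (fastforce simp: disjoint_pairs_def)
  with Cons show ?case by (simp add: R_prod_commute[OF dj])
qed simp

text \<open>Passing from rows to columns reverses the order only of factors whose two indices both
  differ; those act in disjoint positions. The induction splits off one column at a time.\<close>

lemma R_prod_interchange:
  assumes "distinct is" "distinct bs"
    and "\<And>i k b c. \<lbrakk>i \<in> set is; k \<in> set is; i \<noteq> k; b \<in> set bs; c \<in> set bs; b \<noteq> c\<rbrakk>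
      \<Longrightarrow> disjoint_pairs (L i b) (L k c)"
  shows "R_prod x (concat (map (\<lambda>i. concat (map (L i) bs)) is)) t
    = R_prod x (concat (map (\<lambda>b. concat (map (\<lambda>i. L i b) is)) bs)) t"
  using assms(2,3)
proof (induction bs)
  case Nil
  have "concat (map (\<lambda>i. []) is) = ([] :: (nat \<times> nat) list)" by (induction "is") auto
  then show ?case by (simp only: list.map concat.simps)
next
  case (Cons b bs)
  have "R_prod x (concat (map (\<lambda>i. L i b @ concat (map (L i) bs)) is)) t
    = R_prod x (concat (map (\<lambda>i. L i b) is)) (R_prod x (concat (map (\<lambda>i. concat (map (L i) bs)) is)) t)"
  proof (rule R_prod_concat_append[OF assms(1)])
    fix i k assume ik: "i \<in> set is" "k \<in> set is" "i \<noteq> k"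
    have "disjoint_pairs (L i c) (L k b)" if "c \<in> set bs" for c
      using Cons.prems that ik by auto
    then show "disjoint_pairs (concat (map (L i) bs)) (L k b)"
      by (fastforce simp: disjoint_pairs_def)
  qed
  also have "R_prod x (concat (map (\<lambda>i. concat (map (L i) bs)) is)) t
      = R_prod x (concat (map (\<lambda>b. concat (map (\<lambda>i. L i b) is)) bs)) t"
    using Cons by auto
  finally show ?case by simp
qed

text \<open>Covers the segments that a block does not touch: flips inside \<open>S\<close> commute
  with every factor.\<close>

lemma antisymmetric_in_R_prod_disjoint:
  assumes "antisymmetric_in S t" "\<And>p q. (p, q) \<in> set L \<Longrightarrow> p \<notin> S \<and> q \<notin> S"
  shows "antisymmetric_in S (R_prod x L t)"
  using assms
proof (induction L)
  case (Cons e L)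
  obtain p q where e: "e = (p, q)" by fastforce
  have pq: "p \<notin> S" "q \<notin> S" using Cons.prems(2) by (auto simp: e)
  have IH: "antisymmetric_in S (R_prod x L t)"
    using Cons.prems by (intro Cons.IH) auto
  show ?case
    unfolding antisymmetric_in_def
  proof (intro ballI impI)
    fix r s assume rs: "r \<in> S" "s \<in> S" "r \<noteq> s"
    then have "{p, q} \<inter> {r, s} = {}" using pq by auto
    then have "flip_tensor r s (R_prod x (e # L) t)
        = R_op p q (x q - x p) (flip_tensor r s (R_prod x L t))"
      by (simp add: e flip_tensor_R_op)
    also have "flip_tensor r s (R_prod x L t) = (\<lambda>j. - R_prod x L t j)"
      using IH rs by (simp add: antisymmetric_in_def)
    finally show "flip_tensor r s (R_prod x (e # L) t) = (\<lambda>j. - R_prod x (e # L) t j)"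
      by (simp add: e R_op_def flip_tensor_minus)
  qed
qed simp


section \<open>Fusion\<close>

text \<open>
  The telescoping rests on \<open>P\<^sub>c\<^sub>p P\<^sub>c\<^sub>q = P\<^sub>c\<^sub>q P\<^sub>p\<^sub>q\<close>, which acts as \<open>- P\<^sub>c\<^sub>q\<close>, and on
  \<open>1 / (y - 1) - 1 / (y (y - 1)) = 1 / y\<close>.
\<close>

lemma R_prod_star:
  assumes "antisymmetric_in (set qs) t" "distinct qs" "c \<notin> set qs" "qs \<noteq> []"
    and "successively (\<lambda>p q. x q = x p + 1) qs"
    and "\<And>q. q \<in> set qs \<Longrightarrow> x q \<noteq> x c"
  shows "R_prod x (map (Pair c) qs) t
    = (\<lambda>j. t j + inverse (x c - x (hd qs)) * (\<Sum>q\<in>set qs. flip_tensor c q t j))"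
  using assms
proof (induction qs)
  case (Cons p qs)
  show ?case
  proof (cases "qs = []")
    case True
    have "inverse (x p - x c) = - inverse (x c - x p)"
      by (metis inverse_minus_eq minus_diff_eq)
    with True show ?thesis by (simp add: R_op_def)
  next
    case False
    \<comment> \<open>The coefficient to be reached for \<open>p # qs\<close> is
      \<open>1 / y\<close>; the parameter rises by one from \<open>p\<close> to
      \<open>hd qs\<close>, so the tail supplies \<open>1 / (y - 1)\<close>.\<close>
    define y where "y = x c - x p"
    have hd: "x (hd qs) = x p + 1" "successively (\<lambda>p q. x q = x p + 1) qs"
      using Cons.prems(5) False by (auto simp: successively_Cons)
    have y: "y \<noteq> 0" "y - 1 \<noteq> 0"
      using Cons.prems(6)[of p] Cons.prems(6)[of "hd qs"] False hd
      by (auto simp: y_def algebra_simps)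
    have "antisymmetric_in (set qs) t"
      using Cons.prems(1) by (rule antisymmetric_in_subset) auto
    then have IH: "R_prod x (map (Pair c) qs) t
        = (\<lambda>j. t j + inverse (y - 1) * (\<Sum>q\<in>set qs. flip_tensor c q t j))"
      using Cons.IH Cons.prems False hd by (simp add: y_def algebra_simps)
    have flip: "flip_tensor c p (flip_tensor c q t) = (\<lambda>j. - flip_tensor c q t j)"
      if q: "q \<in> set qs" for q
    proof -
      have neq: "c \<noteq> p" "c \<noteq> q" "p \<noteq> q" using q Cons.prems by auto
      have "flip_tensor c q (flip_tensor p q t) = flip_tensor c p (flip_tensor c q t)"
        using neq by (subst flip_tensor_conj) (auto simp: transpose_def flip_tensor_commute)
      moreover have "flip_tensor p q t = (\<lambda>j. - t j)"
        using Cons.prems(1) q neq by (simp add: antisymmetric_in_def)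
      ultimately show ?thesis by (simp add: flip_tensor_minus)
    qed
    have inv: "inverse (x p - x c) = - inverse y"
      unfolding y_def by (metis inverse_minus_eq minus_diff_eq)
    have "inverse w - inverse (w + 1) * inverse w = inverse (w + 1)"
      if "w \<noteq> 0" "w + 1 \<noteq> 0" for w :: complex
      using that by (simp add: divide_simps)
    from this[of "y - 1"] have coeff: "inverse (y - 1) - inverse y * inverse (y - 1) = inverse y"
      using y by simp
    show ?thesis
    proof
      fix j
      let ?s = "\<Sum>q\<in>set qs. flip_tensor c q t j"
      have "R_prod x (map (Pair c) (p # qs)) t j
          = t j + inverse (y - 1) * ?s + inverse y * (flip_tensor c p t j - inverse (y - 1) * ?s)"
        by (simp add: IH R_op_def inv flip_tensor_linear flip sum_negf)
      also have "\<dots> = t j + inverse y * flip_tensor c p t j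
          + (inverse (y - 1) - inverse y * inverse (y - 1)) * ?s"
        by (simp add: algebra_simps)
      also have "\<dots> = t j + inverse y * (flip_tensor c p t j + ?s)"
        by (simp add: coeff algebra_simps)
      finally show "R_prod x (map (Pair c) (p # qs)) t j
          = t j + inverse (x c - x (hd (p # qs))) * (\<Sum>q\<in>set (p # qs). flip_tensor c q t j)"
        using Cons.prems(2) by (simp add: y_def)
    qed
  qed
qed simp

text \<open>Each star keeps the tensor antisymmetric in \<open>set qs\<close> by
  \<open>antisymmetric_in_star\<close>, so fusion applies again to the next centre
  \<open>c\<close>.\<close>

lemma antisymmetric_in_R_prod_stars:
  assumes "antisymmetric_in (set qs) t" "distinct qs" "set cs \<inter> set qs = {}" "qs \<noteq> []"
    and "successively (\<lambda>p q. x q = x p + 1) qs"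
    and "\<And>c q. c \<in> set cs \<Longrightarrow> q \<in> set qs \<Longrightarrow> x q \<noteq> x c"
  shows "antisymmetric_in (set qs) (R_prod x (concat (map (\<lambda>c. map (Pair c) qs) cs)) t)"
  using assms(3,6)
proof (induction cs)
  case (Cons c cs)
  then have IH: "antisymmetric_in (set qs) (R_prod x (concat (map (\<lambda>c. map (Pair c) qs) cs)) t)"
    by simp
  have c: "c \<notin> set qs" "\<And>q. q \<in> set qs \<Longrightarrow> x q \<noteq> x c" using Cons.prems by auto
  show ?case
    using antisymmetric_in_star[OF IH c(1)]
    by (simp add: R_prod_star[OF IH assms(2) c(1) assms(4,5) c(2)])
qed (simp add: assms(1))

text \<open>Fusion leaves one denominator per star, \<open>x z c - x z (hd qs)\<close>. Only its
  inverse has to be regular at \<open>z0\<close>; the other differences need to be nonzero only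
  generically.\<close>

lemma regular_at_R_prod_stars:
  fixes x :: "(nat \<Rightarrow> complex) \<Rightarrow> nat \<Rightarrow> complex"
  assumes "generically m P" "\<And>j. regular_at m (\<lambda>z. T z j) z0"
    and "\<And>z. P z \<Longrightarrow> antisymmetric_in (set qs) (T z)"
    and "distinct qs" "set cs \<inter> set qs = {}" "qs \<noteq> []"
    and "\<And>z. successively (\<lambda>p q. x z q = x z p + 1) qs"
    and "\<And>z c q. P z \<Longrightarrow> c \<in> set cs \<Longrightarrow> q \<in> set qs \<Longrightarrow> x z q \<noteq> x z c"
    and "\<And>c. c \<in> set cs \<Longrightarrow> regular_at m (\<lambda>z. inverse (x z c - x z (hd qs))) z0"
  shows "regular_at m (\<lambda>z. R_prod (x z) (concat (map (\<lambda>c. map (Pair c) qs) cs)) (T z) j) z0"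
  using assms(5,8,9)
proof (induction cs arbitrary: j)
  case (Cons c cs)
  \<comment> \<open>The stars of \<open>cs\<close> are applied before that of \<open>c\<close>, so
    the latter is collapsed on \<open>U z\<close>.\<close>
  define U where "U z = R_prod (x z) (concat (map (\<lambda>c. map (Pair c) qs) cs)) (T z)" for z
  have U: "regular_at m (\<lambda>z. U z j) z0" for j
    unfolding U_def using Cons by auto
  have anti: "antisymmetric_in (set qs) (U z)" if "P z" for z
    unfolding U_def
    by (rule antisymmetric_in_R_prod_stars[OF assms(3)[OF that] assms(4) _ assms(6,7)])
       (use Cons.prems that in auto)
  have "regular_at m (\<lambda>z. U z j + inverse (x z c - x z (hd qs))
      * (\<Sum>q\<in>set qs. flip_tensor c q (U z) j)) z0"
    unfolding flip_tensor_apply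
    by (intro regular_at_add regular_at_mult regular_at_sum U Cons.prems(3)) simp
  then show ?case
  proof (rule regular_at_generic_cong[OF _ assms(1)])
    fix z assume "P z"
    show "U z j + inverse (x z c - x z (hd qs)) * (\<Sum>q\<in>set qs. flip_tensor c q (U z) j)
        = R_prod (x z) (concat (map (\<lambda>c. map (Pair c) qs) (c # cs))) (T z) j"
      using R_prod_star[OF anti[OF \<open>P z\<close>] assms(4) _ assms(6,7), of c] Cons.prems \<open>P z\<close>
      by (simp add: U_def)
  qed
qed (simp add: assms(2))

lemma R_prod_concat_cong:
  assumes "\<And>i t. i \<in> set is \<Longrightarrow> R_prod x (F i) t = R_prod x (G i) t"
  shows "R_prod x (concat (map F is)) t = R_prod x (concat (map G is)) t"
  using assms by (induction "is") auto


section \<open>Segments\<close>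

lemma partial_sum_Suc: "partial_sum \<nu> (Suc a) = partial_sum \<nu> a + \<nu> (Suc a)"
  by (simp add: partial_sum_def)

lemma partial_sum_diff_1: "1 \<le> a \<Longrightarrow> partial_sum \<nu> a = partial_sum \<nu> (a - 1) + \<nu> a"
  using partial_sum_Suc[of \<nu> "a - 1"] by simp

lemma partial_sum_mono: "a \<le> b \<Longrightarrow> partial_sum \<nu> a \<le> partial_sum \<nu> b"
  by (simp add: partial_sum_def sum_mono2)

lemma distinct_segment [simp]: "distinct (segment \<nu> a)"
  by (simp add: segment_def)

lemma set_segment: "set (segment \<nu> a) = {partial_sum \<nu> (a - 1)<..partial_sum \<nu> a}"
  by (auto simp: segment_def)

lemma segment_less:
  assumes "p \<in> set (segment \<nu> a)" "q \<in> set (segment \<nu> b)" "a < b"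
  shows "p < q"
proof -
  have "partial_sum \<nu> a \<le> partial_sum \<nu> (b - 1)" using assms(3) by (intro partial_sum_mono) simp
  with assms show ?thesis by (simp add: set_segment)
qed

lemma segment_disjoint: "a \<noteq> b \<Longrightarrow> set (segment \<nu> a) \<inter> set (segment \<nu> b) = {}"
  using segment_less[of _ \<nu> a _ b] segment_less[of _ \<nu> b _ a] by (cases a b rule: linorder_cases) fastforce+

lemma segment_of_eq:
  assumes "a \<in> {1..m}" "p \<in> set (segment \<nu> a)"
  shows "segment_of m \<nu> p = a"
  unfolding segment_of_def using assms segment_disjoint[of _ a \<nu>]
  by (intro the_equality) (auto dest: segment_disjoint)

lemma segment_Cons:
  assumes "1 \<le> a" "1 \<le> \<nu> a"
  shows "segment \<nu> a = Suc (partial_sum \<nu> (a - 1)) # [partial_sum \<nu> (a - 1) + 2 ..< partial_sum \<nu> a + 1]"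
  using assms partial_sum_diff_1[of a \<nu>] by (simp add: segment_def upt_conv_Cons)

lemma segment_snoc:
  assumes "1 \<le> a" "1 \<le> \<nu> a"
  shows "segment \<nu> a = [partial_sum \<nu> (a - 1) + 1 ..< partial_sum \<nu> a] @ [partial_sum \<nu> a]"
  using assms partial_sum_diff_1[of a \<nu>] by (simp add: segment_def)

text \<open>Lets the first index of \<open>B_pairs\<close> run segment by segment.\<close>

lemma concat_segments: "concat (map (segment \<nu>) [1..<m + 1]) = [1..<partial_sum \<nu> m + 1]"
proof (induction m)
  case 0
  show ?case by (simp add: partial_sum_def)
next
  case (Suc m)
  have "[1..<partial_sum \<nu> (Suc m) + 1]
      = [1..<partial_sum \<nu> m + 1] @ [partial_sum \<nu> m + 1..<partial_sum \<nu> m + 1 + \<nu> (Suc m)]"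
    using upt_add_eq_append[of 1 "partial_sum \<nu> m + 1" "\<nu> (Suc m)"] by (simp add: partial_sum_Suc)
  with Suc show ?case by (simp add: segment_def partial_sum_Suc)
qed

lemma successively_upt: "(\<And>i. P i (Suc i)) \<Longrightarrow> successively P [a..<b]"
proof (induction b)
  case (Suc b)
  then show ?case
    using Suc.prems[of "b - 1"] by (cases b) (auto simp: successively_append_iff)
qed simp

text \<open>This form shows that the parameters are affine in \<open>z\<close> and fall by one from
  each position of a segment to the next.\<close>

lemma x_param_eq:
  assumes "a \<in> {1..m}" "p \<in> set (segment \<nu> a)"
  shows "x_param m \<nu> z p
    = z a + (rho m a + 1 / 2 + of_nat (\<nu> a) + of_nat (partial_sum \<nu> (a - 1)) - of_nat p)"
  using assms by (simp add: x_param_def segment_of_eq[OF assms] Let_def set_segment of_nat_diff)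

text \<open>Parameters fall along a segment, so the reversed order gives the ascending chain that
  fusion needs. This is the order in which \<open>B_pairs\<close> lists \<open>q\<close>.\<close>

lemma successively_x_param_rev_segment:
  assumes "a \<in> {1..m}"
  shows "successively (\<lambda>p q. x_param m \<nu> z q = x_param m \<nu> z p + 1) (rev (segment \<nu> a))"
proof -
  have "successively (\<lambda>p q. q = Suc p) (segment \<nu> a)"
    unfolding segment_def by (rule successively_upt) simp
  then show ?thesis
    unfolding successively_rev
    by (rule successively_mono) (simp_all add: x_param_eq[OF assms])
qed

text \<open>Negating the parameters makes the natural order ascending, as fusion along columns
  requires.\<close>

lemma successively_minus_x_param_segment:
  assumes "a \<in> {1..m}"
  shows "successively (\<lambda>p q. - x_param m \<nu> z q = - x_param m \<nu> z p + 1) (segment \<nu> a)"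
proof -
  have "successively (\<lambda>p q. q = Suc p) (segment \<nu> a)"
    unfolding segment_def by (rule successively_upt) simp
  then show ?thesis
    by (rule successively_mono) (simp_all add: x_param_eq[OF assms])
qed

section \<open>Generic distinctness of the parameters of different segments\<close>

definition separated :: "nat \<Rightarrow> (nat \<Rightarrow> nat) \<Rightarrow> (nat \<Rightarrow> complex) \<Rightarrow> bool" where
  "separated m \<nu> z \<longleftrightarrow> (\<forall>a\<in>{1..m}. \<forall>c\<in>{1..m}. \<forall>p\<in>set (segment \<nu> a). \<forall>q\<in>set (segment \<nu> c).
     a \<noteq> c \<longrightarrow> x_param m \<nu> z p \<noteq> x_param m \<nu> z q)"

lemma separatedD:
  assumes "separated m \<nu> z" "a \<in> {1..m}" "c \<in> {1..m}" "a \<noteq> c"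
    and "p \<in> set (segment \<nu> a)" "q \<in> set (segment \<nu> c)"
  shows "x_param m \<nu> z p \<noteq> x_param m \<nu> z q"
  using assms unfolding separated_def by blast

text \<open>Each of the finitely many conditions removes a hyperplane
  \<open>z a - z c = const\<close>. Off these, no argument of an \<open>R\<close>-matrix in
  \<open>B_op\<close> vanishes and fusion applies.\<close>

lemma generically_separated: "generically m (separated m \<nu>)"
  unfolding separated_def
proof (intro generically_ball finite_atLeastAtMost finite_set)
  fix a c p q
  assume *: "a \<in> {1..m}" "c \<in> {1..m}" "p \<in> set (segment \<nu> a)" "q \<in> set (segment \<nu> c)"
  show "generically m (\<lambda>z. a \<noteq> c \<longrightarrow> x_param m \<nu> z p \<noteq> x_param m \<nu> z q)"
  proof (cases "a = c")
    case True
    then show ?thesis using generically_True by simp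
  next
    case False
    obtain u w where uw: "\<And>z. x_param m \<nu> z p = z a + u" "\<And>z. x_param m \<nu> z q = z c + w"
      using x_param_eq[of a m p \<nu>] x_param_eq[of c m q \<nu>] * by blast
    show ?thesis
      unfolding generically_def
    proof (intro exI[of _ "\<lambda>z. (z a + u) - (z c + w)"] conjI)
      show "polynomial_fun m (\<lambda>z. (z a + u) - (z c + w))"
        using * by (intro polynomial_fun_diff polynomial_fun_coord_add)
      show "\<exists>z. (z a + u) - (z c + w) \<noteq> 0"
        \<comment> \<open>At this point the polynomial takes the value 1.\<close>
        using False by (intro exI[of _ "(\<lambda>_. 0)(a := 1 - u + w)"]) simp
    qed (simp add: uw)
  qed
qed


section \<open>The blocks of \<open>B\<close>\<close>

definition block :: "(nat \<Rightarrow> nat) \<Rightarrow> nat \<times> nat \<Rightarrow> (nat \<times> nat) list" where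
  "block \<nu> = (\<lambda>(a, c). concat (map (\<lambda>p. map (Pair p) (rev (segment \<nu> c))) (segment \<nu> a)))"

text \<open>A list, because the order of the blocks matters; the lexicographic order agrees with
  that of \<open>B_pairs\<close>.\<close>

definition segment_pairs :: "nat \<Rightarrow> (nat \<times> nat) list" where
  "segment_pairs m = filter (\<lambda>(a, c). a < c) (List.product [1..<m + 1] [1..<m + 1])"

lemma set_segment_pairs: "set (segment_pairs m) = {(a, b). 1 \<le> a \<and> a < b \<and> b \<le> m}"
  by (auto simp: segment_pairs_def)

lemma distinct_segment_pairs: "distinct (segment_pairs m)"
  by (simp add: segment_pairs_def distinct_product)

section \<open>Rearranging B into blocks\<close>

lemma concat_map_concat: "concat (map f (concat xss)) = concat (map (\<lambda>xs. concat (map f xs)) xss)"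
  by (induction xss) auto

lemma concat_map_filter: "concat (map f (filter P xs)) = concat (map (\<lambda>e. if P e then f e else []) xs)"
  by (induction xs) auto

lemma concat_map_product:
  "concat (map f (List.product xs ys)) = concat (map (\<lambda>a. concat (map (\<lambda>c. f (a, c)) ys)) xs)"
  by (induction xs) (auto simp: o_def)

lemma concat_map_if_True:
  "(\<And>x. x \<in> set xs \<Longrightarrow> P x) \<Longrightarrow> concat (map (\<lambda>x. if P x then [f x] else []) xs) = map f xs"
  by (induction xs) auto

text \<open>For each segment \<open>a\<close>, \<open>B_pairs\<close> runs through all later
  segments for one position \<open>p\<close> before turning to the next. Interchanging these two
  loops collects the blocks.\<close>

lemma B_op_eq_R_prod:
  "B_op m \<nu> z t = R_prod (x_param m \<nu> z) (concat (map (block \<nu>) (segment_pairs m))) t"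
proof -
  define x where "x = x_param m \<nu> z"
  \<comment> \<open>The part of \<open>B_pairs\<close> with first entry \<open>p\<close> and second
    entry in segment \<open>c\<close>. The test has the same outcome throughout a pair of segments,
    so this is either a full row or empty.\<close>
  define L where "L p c = concat (map (\<lambda>q. if p < q \<and> segment_of m \<nu> p \<noteq> segment_of m \<nu> q
    then [(p, q)] else []) (rev (segment \<nu> c)))" for p c
  have L: "concat (map (\<lambda>p. L p c) (segment \<nu> a)) = (if a < c then block \<nu> (a, c) else [])"
    if "a \<in> {1..m}" "c \<in> {1..m}" for a c
  proof (cases "a < c")
    case True
    have "L p c = map (Pair p) (rev (segment \<nu> c))" if "p \<in> set (segment \<nu> a)" for p
      unfolding L_def
    proof (rule concat_map_if_True)
      fix q assume "q \<in> set (rev (segment \<nu> c))"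
      then show "p < q \<and> segment_of m \<nu> p \<noteq> segment_of m \<nu> q"
        using True \<open>p \<in> _\<close> segment_less[of p \<nu> a q c]
          segment_of_eq[OF \<open>a \<in> _\<close>] segment_of_eq[OF \<open>c \<in> _\<close>] by simp
    qed
    with True show ?thesis by (auto simp: block_def intro!: arg_cong[of _ _ concat])
  next
    case False
    have "L p c = []" if p: "p \<in> set (segment \<nu> a)" for p
    proof -
      have "\<not> (p < q \<and> segment_of m \<nu> p \<noteq> segment_of m \<nu> q)" if q: "q \<in> set (segment \<nu> c)" for q
      proof (cases "a = c")
        case True
        then show ?thesis using p q \<open>a \<in> _\<close> by (simp add: segment_of_eq)
      next
        case neq: False
        then show ?thesis using False segment_less[OF q p] by simp
      qed
      then show ?thesis unfolding L_def by auto
    qed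
    with False show ?thesis by simp
  qed
  have "B_pairs m \<nu> = concat (map (\<lambda>a. concat (map (\<lambda>p. concat (map (L p) [1..<m + 1]))
      (segment \<nu> a))) [1..<m + 1])"
    unfolding B_pairs_def concat_segments[symmetric] double_primed_seq_def concat_map_concat L_def
    by (simp add: o_def del: upt_Suc)
  then have "B_op m \<nu> z t = R_prod x (concat (map (\<lambda>a. concat (map (\<lambda>p. concat (map (L p) [1..<m + 1]))
      (segment \<nu> a))) [1..<m + 1])) t"
    by (simp add: B_op_def R_prod_def x_def)
  also have "\<dots> = R_prod x (concat (map (\<lambda>a. concat (map (\<lambda>c. if a < c then block \<nu> (a, c) else [])
      [1..<m + 1])) [1..<m + 1])) t"
  proof (rule R_prod_concat_cong)
    fix a t assume a: "a \<in> set [1..<m + 1]"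
    have "R_prod x (concat (map (\<lambda>p. concat (map (L p) [1..<m + 1])) (segment \<nu> a))) t
        = R_prod x (concat (map (\<lambda>c. concat (map (\<lambda>p. L p c) (segment \<nu> a))) [1..<m + 1])) t"
    proof (rule R_prod_interchange)
      fix p q b c
      assume *: "p \<in> set (segment \<nu> a)" "q \<in> set (segment \<nu> a)" "p \<noteq> q"
        "b \<in> set [1..<m + 1]" "c \<in> set [1..<m + 1]" "b \<noteq> c"
      \<comment> \<open>Second entries must also avoid segment \<open>a\<close>, since a second
        entry of one list must not meet the first entry of the other.\<close>
      have sub: "r = i \<and> s \<in> set (segment \<nu> e) \<and> s \<notin> set (segment \<nu> a)"
        if "(r, s) \<in> set (L i e)" "i \<in> set (segment \<nu> a)" "e \<in> set [1..<m + 1]" for r s i e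
      proof -
        from that have "r = i" "s \<in> set (segment \<nu> e)" "segment_of m \<nu> i \<noteq> segment_of m \<nu> s"
          by (auto simp: L_def split: if_splits)
        then show ?thesis using that a segment_of_eq[of a m] by (metis atLeastLessThan_iff
          atLeastAtMost_iff less_Suc_eq_le Suc_eq_plus1 set_upt)
      qed
      show "disjoint_pairs (L p b) (L q c)"
        unfolding disjoint_pairs_def
        using sub[of _ _ p b] sub[of _ _ q c] * segment_disjoint[OF \<open>b \<noteq> c\<close>, of \<nu>] by blast
    qed simp_all
    also have "map (\<lambda>c. concat (map (\<lambda>p. L p c) (segment \<nu> a))) [1..<m + 1]
        = map (\<lambda>c. if a < c then block \<nu> (a, c) else []) [1..<m + 1]"
    proof (rule map_cong[OF refl])
      fix c assume "c \<in> set [1..<m + 1]"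
      with a show "concat (map (\<lambda>p. L p c) (segment \<nu> a)) = (if a < c then block \<nu> (a, c) else [])"
        by (intro L) auto
    qed
    finally show "R_prod x (concat (map (\<lambda>p. concat (map (L p) [1..<m + 1])) (segment \<nu> a))) t
        = R_prod x (concat (map (\<lambda>c. if a < c then block \<nu> (a, c) else []) [1..<m + 1])) t" .
  qed
  also have "\<dots> = R_prod x (concat (map (block \<nu>) (segment_pairs m))) t"
    unfolding segment_pairs_def concat_map_filter concat_map_product by simp
  finally show ?thesis unfolding x_def .
qed

text \<open>Applied to singleton lists, the interchange transposes the rectangle of pairs; swapping
  each pair makes every column a star centred in segment \<open>c\<close>.\<close>

lemma R_prod_block_columns:
  assumes "a \<noteq> c"
  shows "R_prod x (block \<nu> (a, c)) t
    = R_prod (\<lambda>p. - x p) (concat (map (\<lambda>q. map (Pair q) (segment \<nu> a)) (rev (segment \<nu> c)))) t"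
proof -
  have "R_prod x (concat (map (\<lambda>p. concat (map (\<lambda>q. [(p, q)]) (rev (segment \<nu> c)))) (segment \<nu> a))) t
    = R_prod x (concat (map (\<lambda>q. concat (map (\<lambda>p. [(p, q)]) (segment \<nu> a))) (rev (segment \<nu> c)))) t"
    using segment_disjoint[OF assms, of \<nu>]
    by (intro R_prod_interchange) (auto simp: disjoint_pairs_def)
  moreover have "concat (map (\<lambda>q. concat (map (\<lambda>p. [(p, q)]) (segment \<nu> a))) (rev (segment \<nu> c)))
    = map prod.swap (concat (map (\<lambda>q. map (Pair q) (segment \<nu> a)) (rev (segment \<nu> c))))"
    by (simp add: map_concat o_def)
  ultimately show ?thesis
    by (simp add: block_def R_prod_swap[symmetric])
qed

text \<open>Rows preserve antisymmetry in segment \<open>c\<close>, columns in segment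
  \<open>a\<close>, and all other segments are untouched. Thus the next block can be fused as
  well.\<close>

lemma antisymmetric_in_R_prod_block:
  assumes "1 \<le> a" "a < c" "c \<le> m" "1 \<le> \<nu> a" "1 \<le> \<nu> c" "separated m \<nu> z"
    and anti: "\<And>b. b \<in> {1..m} \<Longrightarrow> antisymmetric_in (set (segment \<nu> b)) t"
    and b: "b \<in> {1..m}"
  shows "antisymmetric_in (set (segment \<nu> b)) (R_prod (x_param m \<nu> z) (block \<nu> (a, c)) t)"
proof -
  have ac: "a \<in> {1..m}" "c \<in> {1..m}" "a \<noteq> c" using assms by auto
  have ne: "segment \<nu> a \<noteq> []" "segment \<nu> c \<noteq> []" using assms by (simp_all add: segment_Cons)
  have dj: "set (segment \<nu> a) \<inter> set (segment \<nu> c) = {}" using segment_disjoint ac(3) .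
  have sep: "x_param m \<nu> z p \<noteq> x_param m \<nu> z q"
    if "p \<in> set (segment \<nu> a)" "q \<in> set (segment \<nu> c)" for p q
    using separatedD[OF assms(6) ac that] .
  consider "b = a" | "b = c" | "b \<noteq> a" "b \<noteq> c" by blast
  then show ?thesis
  proof cases
    case 1
    have "antisymmetric_in (set (segment \<nu> a)) (R_prod (\<lambda>p. - x_param m \<nu> z p)
        (concat (map (\<lambda>q. map (Pair q) (segment \<nu> a)) (rev (segment \<nu> c)))) t)"
      using anti[OF ac(1)] ne dj sep successively_minus_x_param_segment[OF ac(1)]
      by (intro antisymmetric_in_R_prod_stars) auto
    then show ?thesis by (simp add: 1 R_prod_block_columns[OF ac(3)])
  next
    case 2
    have "antisymmetric_in (set (rev (segment \<nu> c))) (R_prod (x_param m \<nu> z)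
        (concat (map (\<lambda>p. map (Pair p) (rev (segment \<nu> c))) (segment \<nu> a))) t)"
      using anti[OF ac(2)] ne dj sep successively_x_param_rev_segment[OF ac(2)]
      by (intro antisymmetric_in_R_prod_stars) (auto dest: not_sym)
    then show ?thesis by (simp add: 2 block_def)
  next
    case 3
    then show ?thesis
      using anti[OF b] segment_disjoint[of b a \<nu>] segment_disjoint[of b c \<nu>]
      by (intro antisymmetric_in_R_prod_disjoint) (auto simp: block_def)
  qed
qed

section \<open>Normalisation by beta and cancellation of poles\<close>

definition beta_factor :: "nat \<Rightarrow> (nat \<Rightarrow> nat) \<Rightarrow> (nat \<Rightarrow> complex) \<Rightarrow> nat \<times> nat \<Rightarrow> complex" where
  "beta_factor m \<nu> z = (\<lambda>(a, b). let l = (\<lambda>a. z a + of_nat (\<nu> a)) in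
     if \<nu> a \<le> \<nu> b
     then (l a - l b + rho m a - rho m b + of_nat (\<nu> b)) / (z a - z b + rho m a - rho m b)
     else (l a - l b + rho m a - rho m b + of_nat (\<nu> b)) / (l a - l b + rho m a - rho m b))"

lemma beta_eq_prod_list: "beta m \<nu> z = (\<Prod>e\<leftarrow>segment_pairs m. beta_factor m \<nu> z e)"
  unfolding prod.distinct_set_conv_list[OF distinct_segment_pairs, symmetric]
  by (simp add: set_segment_pairs beta_def beta_factor_def Let_def)

text \<open>
  With \<open>d\<close> the difference of the coordinates of \<open>\<lambda> + \<rho>\<close>, the block fused along rows has its poles
  at \<open>d = i - \<nu> c\<close> for \<open>1 \<le> i \<le> \<nu> a\<close>, and fused along columns at \<open>d = 1 - k\<close> for
  \<open>1 \<le> k \<le> \<nu> c\<close>. Hence the row form has no dominant pole if \<open>\<nu> a < \<nu> c\<close>, and otherwise the only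
  dominant pole of the column form is a simple one at \<open>d = 0\<close>, a zero of \<open>1 / \<beta>\<close>.
\<close>

lemma regular_at_R_prod_block:
  assumes ac: "1 \<le> a" "a < c" "c \<le> m" and \<nu>: "1 \<le> \<nu> a" "1 \<le> \<nu> c"
    and dom: "\<And>k::nat. 1 \<le> k \<Longrightarrow>
      z0 a + of_nat (\<nu> a) + rho m a - (z0 c + of_nat (\<nu> c) + rho m c) \<noteq> - of_nat k"
    and reg: "\<And>j. regular_at m (\<lambda>z. T z j) z0"
    and anti: "\<And>z b. separated m \<nu> z \<Longrightarrow> b \<in> {1..m} \<Longrightarrow> antisymmetric_in (set (segment \<nu> b)) (T z)"
  shows "regular_at m (\<lambda>z. inverse (beta_factor m \<nu> z (a, c))
    * R_prod (x_param m \<nu> z) (block \<nu> (a, c)) (T z) j) z0"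
proof -
  have ac': "a \<in> {1..m}" "c \<in> {1..m}" "a \<noteq> c" using ac by auto
  have dj: "set (segment \<nu> a) \<inter> set (segment \<nu> c) = {}" using segment_disjoint ac'(3) .
  have ne: "segment \<nu> a \<noteq> []" "segment \<nu> c \<noteq> []" using ac \<nu> by (simp_all add: segment_Cons)
  have sep: "x_param m \<nu> z p \<noteq> x_param m \<nu> z q" "x_param m \<nu> z q \<noteq> x_param m \<nu> z p"
    if "separated m \<nu> z" "p \<in> set (segment \<nu> a)" "q \<in> set (segment \<nu> c)" for z p q
    using separatedD[OF that(1) ac' that(2,3)] by auto
  define d where "d z = z a + of_nat (\<nu> a) + rho m a - (z c + of_nat (\<nu> c) + rho m c)" for z
  have d_poly: "polynomial_fun m (\<lambda>z. d z + w)" for w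
    unfolding d_def using ac'
    by (intro polynomial_fun.add polynomial_fun_diff polynomial_fun.coord polynomial_fun.const)
  \<comment> \<open>Dominance forbids \<open>d z0 = - of_nat k\<close> for \<open>k \<ge> 1\<close>;
    \<open>d z0 = 0\<close> remains possible.\<close>
  have d0: "d z0 + of_nat k \<noteq> 0" if "1 \<le> k" for k
    using dom[OF that] by (metis add_eq_0_iff2 d_def)
  have inv_d: "regular_at m (\<lambda>z. inverse (d z + of_nat k)) z0" if "1 \<le> k" for k
    by (rule regular_at_inverse[OF d_poly d0[OF that]])
  have x_diff: "x_param m \<nu> z p - x_param m \<nu> z q
      = d z + (of_nat (partial_sum \<nu> (a - 1)) - of_nat p)
          - (of_nat (partial_sum \<nu> (c - 1)) - of_nat q)"
    if "p \<in> set (segment \<nu> a)" "q \<in> set (segment \<nu> c)" for z p q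
    using that by (simp add: x_param_eq[OF ac'(1)] x_param_eq[OF ac'(2)] d_def)
  show ?thesis
  proof (cases "\<nu> a < \<nu> c")
    case True
    have "beta_factor m \<nu> z (a, c)
        = (d z + of_nat (\<nu> c)) / (d z + (of_nat (\<nu> c) - of_nat (\<nu> a)))" for z
      using True by (simp add: beta_factor_def d_def Let_def algebra_simps)
    then have "inverse (beta_factor m \<nu> z (a, c))
        = (d z + (of_nat (\<nu> c) - of_nat (\<nu> a))) * inverse (d z + of_nat (\<nu> c))" for z
      by (simp add: divide_inverse)
    then have "regular_at m (\<lambda>z. inverse (beta_factor m \<nu> z (a, c))) z0"
      using regular_at_mult[OF regular_at_polynomial_fun[OF d_poly] inv_d[OF \<nu>(2)]] by simp
    moreover have "regular_at m (\<lambda>z. R_prod (x_param m \<nu> z) (block \<nu> (a, c)) (T z) j) z0"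
      unfolding block_def prod.case
    proof (rule regular_at_R_prod_stars[OF generically_separated[of m \<nu>] reg])
      fix p assume p: "p \<in> set (segment \<nu> a)"
      \<comment> \<open>With \<open>i\<close> the place of \<open>p\<close> in its segment,
        \<open>k = \<nu> c - i\<close>, and \<open>i \<le> \<nu> a < \<nu> c\<close> makes it
        positive.\<close>
      define k where "k = partial_sum \<nu> (a - 1) + \<nu> c - p"
      have "p \<le> partial_sum \<nu> (a - 1) + \<nu> a"
        using p partial_sum_diff_1[OF ac(1), of \<nu>] by (simp add: set_segment)
      then have k: "1 \<le> k" "of_nat (partial_sum \<nu> (a - 1)) + of_nat (\<nu> c) - of_nat p = (of_nat k :: complex)"
        using True by (simp_all add: k_def of_nat_diff)
      have hd: "hd (rev (segment \<nu> c)) = partial_sum \<nu> c"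
        using segment_snoc[of c \<nu>] ac \<nu> by simp
      have "partial_sum \<nu> c \<in> set (segment \<nu> c)"
        using segment_snoc[of c \<nu>] ac \<nu> by simp
      moreover have "of_nat (partial_sum \<nu> c)
          = (of_nat (partial_sum \<nu> (c - 1)) + of_nat (\<nu> c) :: complex)"
        using partial_sum_diff_1[of c \<nu>] ac by simp
      ultimately have "x_param m \<nu> z p - x_param m \<nu> z (hd (rev (segment \<nu> c))) = d z + of_nat k" for z
        by (simp add: hd x_diff[OF p] k(2)[symmetric])
      then show "regular_at m (\<lambda>z. inverse (x_param m \<nu> z p - x_param m \<nu> z (hd (rev (segment \<nu> c))))) z0"
        using inv_d[OF k(1)] by simp
    qed (use anti ac' ne dj sep successively_x_param_rev_segment[OF ac'(2)] in auto)
    ultimately show ?thesis by (rule regular_at_mult)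
  next
    case False
    define s where "s z = inverse (beta_factor m \<nu> z (a, c))" for z
    \<comment> \<open>If \<open>\<nu> a = \<nu> c\<close>, the first branch of
      \<open>beta_factor\<close> applies, and its denominator is also \<open>d z\<close>.\<close>
    have "beta_factor m \<nu> z (a, c) = (d z + of_nat (\<nu> c)) / d z" for z
      using False by (auto simp: beta_factor_def d_def Let_def algebra_simps)
    then have s: "s z = d z * inverse (d z + of_nat (\<nu> c))" for z
      by (simp add: s_def divide_inverse)
    have s_reg: "regular_at m s z0"
      using regular_at_mult[OF regular_at_polynomial_fun[OF d_poly[of 0]] inv_d[OF \<nu>(2)]]
      by (simp add: s[abs_def])
    \<comment> \<open>The first position of segment \<open>c\<close> gives the last column of the
      reversed list, hence the one applied first. Its pole is at \<open>d z = 0\<close>.\<close>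
    define q1 where "q1 = Suc (partial_sum \<nu> (c - 1))"
    define qs where "qs = [partial_sum \<nu> (c - 1) + 2 ..< partial_sum \<nu> c + 1]"
    have seg: "segment \<nu> c = q1 # qs"
      using segment_Cons[of c \<nu>] ac \<nu> by (simp add: q1_def qs_def)
    have q1: "q1 \<in> set (segment \<nu> c)" by (simp add: seg)
    have hd: "hd (segment \<nu> a) = Suc (partial_sum \<nu> (a - 1))"
      using segment_Cons[of a \<nu>] ac \<nu> by simp
    have x_hd: "x_param m \<nu> z (hd (segment \<nu> a)) - x_param m \<nu> z q
        = d z + of_nat (q - q1)" if "q \<in> set (segment \<nu> c)" for z q
      using x_diff[OF hd_in_set[OF ne(1)] that, of z] that
      by (simp add: hd q1_def set_segment of_nat_diff)
    define y where "y z p = - x_param m \<nu> z p" for z p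
    have y_hd: "y z q - y z (hd (segment \<nu> a)) = d z + of_nat (q - q1)"
      if "q \<in> set (segment \<nu> c)" for z q
      using x_hd[OF that, of z] by (simp add: y_def algebra_simps)
    have y_succ: "successively (\<lambda>p q. y z q = y z p + 1) (segment \<nu> a)" for z
      unfolding y_def by (rule successively_minus_x_param_segment[OF ac'(1)])
    have y_sep: "y z p \<noteq> y z q" if "separated m \<nu> z" "p \<in> set (segment \<nu> a)" "q \<in> set (segment \<nu> c)" for z p q
      using sep[OF that] by (simp add: y_def)
    have q1_notin: "q1 \<notin> set (segment \<nu> a)" using dj q1 by auto
    \<comment> \<open>The whole scalar \<open>s z\<close> is spent on this column: its factor
      \<open>d z\<close> cancels the pole, leaving
      \<open>inverse (d z + of_nat (\<nu> c))\<close>.\<close>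
    define U where "U z = (\<lambda>j. s z * R_prod (y z) (map (Pair q1) (segment \<nu> a)) (T z) j)" for z
    have U_reg: "regular_at m (\<lambda>z. U z j) z0" for j
    proof -
      have "regular_at m (\<lambda>z. s z * T z j
          + inverse (d z + of_nat (\<nu> c)) * (\<Sum>p\<in>set (segment \<nu> a). flip_tensor q1 p (T z) j)) z0"
        unfolding flip_tensor_apply
        by (intro regular_at_add regular_at_mult regular_at_sum s_reg inv_d[OF \<nu>(2)] reg)
      then show ?thesis
      proof (rule regular_at_generic_cong[OF _ generically_separated[of m \<nu>]])
        fix z assume z: "separated m \<nu> z"
        \<comment> \<open>\<open>d z\<close> is a difference of parameters from segments
          \<open>a\<close> and \<open>c\<close>, hence nonzero at separated points.\<close>
        have d: "d z \<noteq> 0"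
          using y_hd[OF q1, of z] y_sep[OF z hd_in_set[OF ne(1)] q1] by auto
        have "U z j = s z * (T z j + inverse (d z) * (\<Sum>p\<in>set (segment \<nu> a). flip_tensor q1 p (T z) j))"
          using R_prod_star[OF anti[OF z ac'(1)] distinct_segment q1_notin ne(1) y_succ y_sep[OF z _ q1]]
            y_hd[OF q1, of z] by (simp add: U_def)
        also have "\<dots> = s z * T z j + (s z * inverse (d z)) * (\<Sum>p\<in>set (segment \<nu> a). flip_tensor q1 p (T z) j)"
          by (simp add: algebra_simps)
        also have "s z * inverse (d z) = inverse (d z + of_nat (\<nu> c))"
          using d by (simp add: s)
        finally show "s z * T z j + inverse (d z + of_nat (\<nu> c))
            * (\<Sum>p\<in>set (segment \<nu> a). flip_tensor q1 p (T z) j) = U z j" by simp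
      qed
    qed
    have U_anti: "antisymmetric_in (set (segment \<nu> a)) (U z)" if "separated m \<nu> z" for z
    proof -
      have "antisymmetric_in (set (segment \<nu> a))
          (R_prod (y z) (concat (map (\<lambda>q. map (Pair q) (segment \<nu> a)) [q1])) (T z))"
        by (rule antisymmetric_in_R_prod_stars)
           (use anti[OF that ac'(1)] q1 q1_notin ne(1) y_succ y_sep[OF that] in auto)
      then show ?thesis unfolding U_def by (intro antisymmetric_in_scale) simp
    qed
    \<comment> \<open>For the remaining columns the denominators are
      \<open>d z + of_nat (q - q1)\<close> with \<open>q - q1 \<ge> 1\<close>.\<close>
    have "regular_at m (\<lambda>z. R_prod (y z) (concat (map (\<lambda>q. map (Pair q) (segment \<nu> a)) (rev qs))) (U z) j) z0"
    proof (rule regular_at_R_prod_stars[OF generically_separated[of m \<nu>] U_reg U_anti])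
      fix q assume "q \<in> set (rev qs)"
      then have q: "q \<in> set (segment \<nu> c)" "1 \<le> q - q1" by (auto simp: seg qs_def q1_def)
      then show "regular_at m (\<lambda>z. inverse (y z q - y z (hd (segment \<nu> a)))) z0"
        using inv_d[OF q(2)] by (simp add: y_hd[OF q(1)])
    next
      fix z q p assume "separated m \<nu> z" "q \<in> set (rev qs)" "p \<in> set (segment \<nu> a)"
      then show "y z p \<noteq> y z q" using y_sep by (simp add: seg)
    qed (use ne dj y_succ seg in auto)
    moreover have "R_prod (y z) (concat (map (\<lambda>q. map (Pair q) (segment \<nu> a)) (rev qs))) (U z) j
        = s z * R_prod (x_param m \<nu> z) (block \<nu> (a, c)) (T z) j" for z
      unfolding R_prod_block_columns[OF ac'(3)] seg U_def R_prod_scale by (simp add: y_def[abs_def])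
    ultimately show ?thesis by (simp add: s_def)
  qed
qed

text \<open>Blocks are added on the left, that is, applied last. Regularity and antisymmetry are
  proved together because fusing the new block needs the antisymmetry left by the earlier
  ones.\<close>

lemma regular_at_R_prod_blocks:
  assumes \<nu>: "\<And>a. a \<in> {1..m} \<Longrightarrow> 1 \<le> \<nu> a"
    and dom: "dominant m (\<lambda>a. z0 a + of_nat (\<nu> a) + rho m a)"
    and anti: "\<And>b. b \<in> {1..m} \<Longrightarrow> antisymmetric_in (set (segment \<nu> b)) t"
    and "set es \<subseteq> set (segment_pairs m)"
  shows "\<And>j. regular_at m (\<lambda>z. inverse (\<Prod>e\<leftarrow>es. beta_factor m \<nu> z e)
      * R_prod (x_param m \<nu> z) (concat (map (block \<nu>) es)) t j) z0"
    and "\<And>z b. separated m \<nu> z \<Longrightarrow> b \<in> {1..m} \<Longrightarrow>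
      antisymmetric_in (set (segment \<nu> b)) (R_prod (x_param m \<nu> z) (concat (map (block \<nu>) es)) t)"
  using assms(4)
proof (induction es)
  case Nil
  { case 1 show ?case by (simp add: regular_at_const)
  next
    case 2 then show ?case by (simp add: anti) }
next
  case (Cons e es)
  obtain a c where e: "e = (a, c)" by fastforce
  { case (1 j)
    then have ac: "1 \<le> a" "a < c" "c \<le> m" by (auto simp: e set_segment_pairs)
    \<comment> \<open>\<open>T\<close> already includes the factors of \<open>beta\<close> belonging
      to the tail, so only the factor of the new block remains to be divided out.\<close>
    define T where "T z = (\<lambda>j. inverse (\<Prod>e\<leftarrow>es. beta_factor m \<nu> z e)
        * R_prod (x_param m \<nu> z) (concat (map (block \<nu>) es)) t j)" for z
    have "regular_at m (\<lambda>z. inverse (beta_factor m \<nu> z (a, c))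
        * R_prod (x_param m \<nu> z) (block \<nu> (a, c)) (T z) j) z0"
    proof (rule regular_at_R_prod_block[OF ac])
      show "1 \<le> \<nu> a" "1 \<le> \<nu> c" using \<nu> ac by auto
      show "z0 a + of_nat (\<nu> a) + rho m a - (z0 c + of_nat (\<nu> c) + rho m c) \<noteq> - of_nat k"
        if "1 \<le> k" for k :: nat
        using dom ac that unfolding dominant_def by blast
      show "regular_at m (\<lambda>z. T z j) z0" for j
        unfolding T_def using Cons.IH(1) 1 by simp
      show "antisymmetric_in (set (segment \<nu> b)) (T z)" if "separated m \<nu> z" "b \<in> {1..m}" for z b
        unfolding T_def using Cons.IH(2)[OF that] 1 by (intro antisymmetric_in_scale) simp
    qed
    then show ?case by (simp add: T_def R_prod_scale e mult.assoc)
  next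
    case (2 z b)
    then have "1 \<le> a" "a < c" "c \<le> m" by (auto simp: e set_segment_pairs)
    then have "antisymmetric_in (set (segment \<nu> b)) (R_prod (x_param m \<nu> z) (block \<nu> (a, c))
        (R_prod (x_param m \<nu> z) (concat (map (block \<nu>) es)) t))"
      using 2 Cons.IH(2)[OF 2(1)] \<nu> by (intro antisymmetric_in_R_prod_block) auto
    then show ?case by (simp add: e) }
qed

theorem theorem2p7:
  fixes n m :: nat and \<nu> :: "nat \<Rightarrow> nat" and \<mu> lam :: "nat \<Rightarrow> complex"
  assumes "n \<ge> 2" and "m \<ge> 1"
    and "\<forall>a\<in>{1..m}. \<nu> a \<in> {1..n - 1}"
    and "\<forall>a\<in>{1..m}. lam a = \<mu> a + of_nat (\<nu> a)"
    and "dominant m (\<lambda>a. lam a + rho m a)"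
  shows "operator_regular_at m (exterior_tensors n m \<nu>) (I_op m \<nu>) \<mu>"
  unfolding operator_regular_at_def
proof (intro ballI allI)
  fix t j
  assume t: "t \<in> exterior_tensors n m \<nu>"
  have dom: "dominant m (\<lambda>a. \<mu> a + of_nat (\<nu> a) + rho m a)"
    using assms(4,5) by (simp add: dominant_def)
  \<comment> \<open>\<open>P_op\<close> only relabels multi-indices, so coefficient \<open>j\<close>
    of the image is, up to the scalar, a single coefficient of \<open>B_op\<close>.\<close>
  have "regular_at m (\<lambda>z. inverse (beta m \<nu> z) * B_op m \<nu> z t (j \<circ> inv (prime_perm m \<nu>))) \<mu>"
    unfolding beta_eq_prod_list B_op_eq_R_prod
  proof (rule regular_at_R_prod_blocks[OF _ dom])
    show "1 \<le> \<nu> a" if "a \<in> {1..m}" for a using assms(3) that by auto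
    show "antisymmetric_in (set (segment \<nu> b)) t" if "b \<in> {1..m}" for b
      using t that by (simp add: exterior_tensors_def antisymmetric_in_def)
  qed simp
  then show "regular_at m (\<lambda>z. I_op m \<nu> z t j) \<mu>"
    by (simp add: I_op_def P_op_def permute_tensor_def divide_inverse mult.commute)
qed

end
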